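(* For all integers $n>0$, $A$, $B$, $$f(n;A,B)=f(n-1;A-1,B-A+1)+f(n-1;A,B-A)+A\,f(n-1;A,B-A+1)+(A+1)\,f(n-1;A+1,B-A),$$ with initial conditions $f(0;0,0)=1$ and $f(0;A,B)=0$ for $(A,B)\ne(0,0)$.
   Context: A marked set partition of $[n]=\{1,\dots,n\}$ is a set partition of $[n]$ in which each block is marked either open or closed. For a marked set partition $\lambda$ with blocks $\mathbf{B}_1,\mathbf{B}_2,\dots$, let $o(\lambda)$ be the number of open blocks and $\ell(\lambda)$ the total number of blocks, and define $$\tilde d(\lambda)=\sum_{\mathbf{B}_j\text{ closed}}\max(\mathbf{B}_j)-\sum_{\mathbf{B}_j}\min(\mathbf{B}_j)+\ell(\lambda)+n\,(o(\lambda)-1).$$ For integers $n\ge 0$, $A$, $B$, let $f(n;A,B)$ be the number of marked set partitions $\lambda$ of $[n]$ with $o(\lambda)=A$ and $\tilde d(\lambda)=B$ (so $f(n;A,B)=0$ for $A<0$). When $o(\lambda)=0$, $\tilde d(\lambda)$ equals the dimension exponent $\sum_j(\max\mathbf{B}_j-\min\mathbf{B}_j+1)-n$ of the underlying set partition. *)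

theory Defs
  imports "HOL-Library.Disjoint_Sets"
begin

text \<open>A marked set partition is a pair \<open>(P, Q)\<close>: the blocks in \<open>Q \<subseteq> P\<close> are marked open,
  those in \<open>P - Q\<close> closed.\<close>

type_synonym marked_partition = "nat set set \<times> nat set set"

definition marked_partitions :: "nat \<Rightarrow> marked_partition set" where
  "marked_partitions n = {(P, Q). partition_on {1..n} P \<and> Q \<subseteq> P}"

definition blocks :: "marked_partition \<Rightarrow> nat set set" where
  "blocks l = fst l"

definition open_blocks :: "marked_partition \<Rightarrow> nat set set" where
  "open_blocks l = snd l"

definition closed_blocks :: "marked_partition \<Rightarrow> nat set set" where
  "closed_blocks l = blocks l - open_blocks l"

definition num_blocks :: "marked_partition \<Rightarrow> int" where
  "num_blocks l = int (card (blocks l))"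

definition num_open :: "marked_partition \<Rightarrow> int" where
  "num_open l = int (card (open_blocks l))"

definition dtilde :: "nat \<Rightarrow> marked_partition \<Rightarrow> int" where
  "dtilde n l = (\<Sum>b\<in>closed_blocks l. int (Max b)) - (\<Sum>b\<in>blocks l. int (Min b))
     + num_blocks l + int n * (num_open l - 1)"

definition f :: "nat \<Rightarrow> int \<Rightarrow> int \<Rightarrow> nat" where
  "f n A B = card {l \<in> marked_partitions n. num_open l = A \<and> dtilde n l = B}"

lemma finite_marked_partitions: "finite (marked_partitions n)"
proof (rule finite_subset)
  show "marked_partitions n \<subseteq> Pow (Pow {1..n}) \<times> Pow (Pow {1..n})"
    unfolding marked_partitions_def partition_on_def by blast
qed simp

end

theory Submission
  imports Defs
begin

text \<open>Deleting the largest element \<open>Suc m\<close> from its block gives the recursion. If \<open>{Suc m}\<close> is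
  a block, it is removed (first two summands). If \<open>Suc m\<close> lies in a larger block \<open>insert (Suc m) b\<close>,
  the remaining block \<open>b\<close> is always marked open: closing an open block amounts to appending its
  maximum. Conversely \<open>b\<close> may be any open block, which gives the factors \<open>A\<close> and \<open>A + 1\<close>.\<close>

section \<open>Four ways of inserting a new largest element\<close>

definition add_open :: "nat \<Rightarrow> marked_partition \<Rightarrow> marked_partition" where
  "add_open m l = (insert {Suc m} (fst l), insert {Suc m} (snd l))"

definition add_closed :: "nat \<Rightarrow> marked_partition \<Rightarrow> marked_partition" where
  "add_closed m l = (insert {Suc m} (fst l), snd l)"

definition extend_open :: "nat \<Rightarrow> marked_partition \<times> nat set \<Rightarrow> marked_partition" where
  "extend_open m = (\<lambda>(l, b). (insert (insert (Suc m) b) (fst l - {b}),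
     insert (insert (Suc m) b) (snd l - {b})))"

text \<open>The enlarged block joins the first component only, so it becomes closed although
  \<open>b\<close> was open.\<close>

definition extend_closed :: "nat \<Rightarrow> marked_partition \<times> nat set \<Rightarrow> marked_partition" where
  "extend_closed m = (\<lambda>(l, b). (insert (insert (Suc m) b) (fst l - {b}), snd l - {b}))"

text \<open>The common domain of both extension maps. Taking the chosen open block as part of the
  argument makes these maps injective and turns the multiplicities of the recursion into a
  cardinality.\<close>

definition pointed_partitions :: "nat \<Rightarrow> (marked_partition \<times> nat set) set" where
  "pointed_partitions m = Sigma (marked_partitions m) open_blocks"

section \<open>Set partitions when the largest element is added or deleted\<close>

lemma partition_block_facts:
  assumes "partition_on {1..m} P" "b \<in> P"
  shows "finite b" "b \<noteq> {}" "Suc m \<notin> b" "\<And>x. x \<in> b \<Longrightarrow> x \<le> m"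
    and "insert (Suc m) b \<notin> P"
proof -
  have sub: "c \<subseteq> {1..m}" if "c \<in> P" for c
    using assms(1) that by (auto simp: partition_on_def)
  show "finite b" using sub[OF assms(2)] finite_subset by blast
  show "b \<noteq> {}" using assms by (auto simp: partition_on_def)
  show "Suc m \<notin> b" "\<And>x. x \<in> b \<Longrightarrow> x \<le> m" using sub[OF assms(2)] by auto
  show "insert (Suc m) b \<notin> P" using sub by fastforce
qed

lemma singleton_not_in_partition:
  assumes "partition_on {1..m} P"
  shows "{Suc m} \<notin> P"
  using partition_block_facts(3)[OF assms, of "{Suc m}"] by auto

lemma partition_add_singleton:
  assumes "partition_on {1..m} P"
  shows "partition_on {1..Suc m} (insert {Suc m} P)"
proof (rule partition_onI)
  have "\<Union>(insert {Suc m} P) = insert (Suc m) {1..m}" using assms by (auto simp: partition_on_def)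
  thus "\<Union>(insert {Suc m} P) = {1..Suc m}" by (simp add: atLeastAtMostSuc_conv)
  show "disjnt p q" if "p \<in> insert {Suc m} P" "q \<in> insert {Suc m} P" "p \<noteq> q" for p q
    using that partition_onD2[OF assms] partition_block_facts(3)[OF assms]
    by (auto simp: disjnt_def disjoint_def)
  show "{} \<notin> insert {Suc m} P" using assms by (auto simp: partition_on_def)
qed

lemma partition_extend_block:
  assumes "partition_on {1..m} P" "b \<in> P"
  shows "partition_on {1..Suc m} (insert (insert (Suc m) b) (P - {b}))"
proof (rule partition_onI)
  have U: "\<Union>P = {1..m}" using assms by (simp add: partition_on_def)
  have D: "disjoint P" using assms by (simp add: partition_on_def)
  show "\<Union> (insert (insert (Suc m) b) (P - {b})) = {1..Suc m}"
  proof -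
    have "\<Union> (insert (insert (Suc m) b) (P - {b})) = insert (Suc m) (\<Union>P)"
      using assms(2) by auto
    thus ?thesis by (simp add: U atLeastAtMostSuc_conv)
  qed
  show "disjnt p q" if "p \<in> insert (insert (Suc m) b) (P - {b})"
    "q \<in> insert (insert (Suc m) b) (P - {b})" "p \<noteq> q" for p q
  proof -
    have *: "disjnt (insert (Suc m) b) c" if "c \<in> P - {b}" for c
      using that D partition_block_facts(3)[OF assms(1)] assms(2)
      by (auto simp: disjnt_def disjoint_def)
    have "disjnt c d" if "c \<in> P" "d \<in> P" "c \<noteq> d" for c d
      using that D by (auto simp: disjnt_def disjoint_def)
    thus ?thesis using that * disjnt_sym by blast
  qed
  show "{} \<notin> insert (insert (Suc m) b) (P - {b})"
    using assms by (auto simp: partition_on_def)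
qed

text \<open>Inverse of extending a block: as \<open>c\<close> is not the singleton, the remainder
  \<open>b\<close> is nonempty and can take the place of \<open>c\<close>.\<close>

lemma partition_delete_max:
  assumes "partition_on {1..Suc m} P" "c \<in> P" "Suc m \<in> c" "c \<noteq> {Suc m}"
  defines "b \<equiv> c - {Suc m}"
  shows "partition_on {1..m} (insert b (P - {c}))" "c = insert (Suc m) b" "b \<notin> P"
proof -
  have D: "p \<inter> q = {}" if "p \<in> P" "q \<in> P" "p \<noteq> q" for p q
    using assms(1) that by (auto simp: partition_on_def disjoint_def)
  have U: "\<Union>P = {1..Suc m}" using assms by (simp add: partition_on_def)
  have ne: "b \<noteq> {}" using assms by auto
  show c: "c = insert (Suc m) b" using assms by auto
  show bP: "b \<notin> P"
    \<comment> \<open>If \<open>b\<close> were a block, it would be disjoint from \<open>c\<close>,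
      yet it is a nonempty proper subset of \<open>c\<close>.\<close>
    using D[of b c] ne assms(2,3) by (auto simp: b_def)
  have "\<Union>(insert b (P - {c})) = \<Union>P - {Suc m}"
    \<comment> \<open>By disjointness \<open>Suc m\<close> lies in no block other than
      \<open>c\<close>, so it vanishes from the union.\<close>
    using D[OF assms(2)] assms(2,3) by (auto simp: b_def)
  also have "\<dots> = {1..m}" by (auto simp: U)
  finally have "\<Union>(insert b (P - {c})) = {1..m}" .
  moreover have "disjnt p q" if "p \<in> insert b (P - {c})" "q \<in> insert b (P - {c})" "p \<noteq> q" for p q
  proof -
    have "disjnt b d" if "d \<in> P - {c}" for d
      using that D[OF assms(2), of d] by (auto simp: disjnt_def b_def)
    moreover have "disjnt d e" if "d \<in> P" "e \<in> P" "d \<noteq> e" for d e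
      using that D by (simp add: disjnt_def)
    ultimately show ?thesis using that disjnt_sym by blast
  qed
  moreover have "{} \<notin> insert b (P - {c})"
    using assms(1) ne by (auto simp: partition_on_def)
  ultimately show "partition_on {1..m} (insert b (P - {c}))"
    by (intro partition_onI)
qed

lemma partition_delete_singleton:
  assumes "partition_on {1..Suc m} P" "{Suc m} \<in> P"
  shows "partition_on {1..m} (P - {{Suc m}})"
proof (rule partition_onI)
  have D: "p \<inter> q = {}" if "p \<in> P" "q \<in> P" "p \<noteq> q" for p q
    using assms(1) that by (auto simp: partition_on_def disjoint_def)
  have "\<Union>(P - {{Suc m}}) = \<Union>P - {Suc m}"
    using D[OF assms(2)] by auto
  also have "\<dots> = {1..m}" using assms(1) by (auto simp: partition_on_def)
  finally show "\<Union>(P - {{Suc m}}) = {1..m}" .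
  show "disjnt p q" if "p \<in> P - {{Suc m}}" "q \<in> P - {{Suc m}}" "p \<noteq> q" for p q
    using that D by (auto simp: disjnt_def)
  show "{} \<notin> P - {{Suc m}}" using assms(1) by (auto simp: partition_on_def)
qed

section \<open>Decomposition of the marked partitions\<close>

lemma marked_partitions_Suc:
  "marked_partitions (Suc m) =
     add_open m ` marked_partitions m \<union> add_closed m ` marked_partitions m
     \<union> extend_open m ` pointed_partitions m \<union> extend_closed m ` pointed_partitions m"
  (is "?L = ?R")
proof
  show "?R \<subseteq> ?L"
    by (auto simp: marked_partitions_def pointed_partitions_def open_blocks_def add_open_def
        add_closed_def extend_open_def extend_closed_def simp del: One_nat_def
        intro!: partition_add_singleton partition_extend_block)
  show "?L \<subseteq> ?R"
  proof
    fix l assume "l \<in> ?L"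
    then obtain P Q where l: "l = (P, Q)" and P: "partition_on {1..Suc m} P" and Q: "Q \<subseteq> P"
      by (auto simp: marked_partitions_def)
    show "l \<in> ?R"
    proof (cases "{Suc m} \<in> P")
      case True
      \<comment> \<open>One predecessor serves both markings of the singleton: if it is closed, the
        removal from \<open>Q\<close> changes nothing.\<close>
      let ?l = "(P - {{Suc m}}, Q - {{Suc m}})"
      have "?l \<in> marked_partitions m"
        using partition_delete_singleton[OF P True] Q by (auto simp: marked_partitions_def)
      moreover have "l = add_open m ?l \<or> l = add_closed m ?l"
        using True by (auto simp: l add_open_def add_closed_def)
      ultimately show ?thesis by blast
    next
      case False
      have "Suc m \<in> \<Union>P" using P by (auto simp: partition_on_def)
      then obtain c where c: "c \<in> P" "Suc m \<in> c" by blast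
      with False have "c \<noteq> {Suc m}" by auto
      note del = partition_delete_max[OF P c this]
      let ?b = "c - {Suc m}"
      \<comment> \<open>The remainder is marked open whether or not \<open>c\<close> is in
        \<open>Q\<close>; the marking of \<open>c\<close> only decides which of the two extension
        maps leads back to \<open>l\<close>.\<close>
      let ?l = "(insert ?b (P - {c}), insert ?b (Q - {c}))"
      have "(?l, ?b) \<in> pointed_partitions m"
        using del(1) Q by (auto simp: pointed_partitions_def marked_partitions_def open_blocks_def)
      moreover have "l = extend_open m (?l, ?b) \<or> l = extend_closed m (?l, ?b)"
      proof -
        have "insert c (P - {c} - {?b}) = P" "Q - {c} - {?b} = Q - {c}"
          using c(1) del(3) Q by auto
        moreover have "insert (Suc m) ?b = c" using del(2) by simp
        moreover have "insert c (Q - {c}) = Q \<or> Q - {c} = Q" by auto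
        ultimately show ?thesis by (simp add: l extend_open_def extend_closed_def) metis
      qed
      ultimately show ?thesis by blast
    qed
  qed
qed

section \<open>Disjointness of the images and injectivity\<close>

lemma singleton_in_add:
  "{Suc m} \<in> snd (add_open m l)" "{Suc m} \<in> fst (add_open m l)" "{Suc m} \<in> fst (add_closed m l)"
  by (auto simp: add_open_def add_closed_def)

lemma singleton_notin_add_closed:
  "l \<in> marked_partitions m \<Longrightarrow> {Suc m} \<notin> snd (add_closed m l)"
  using singleton_not_in_partition by (auto simp: add_closed_def marked_partitions_def)

text \<open>The extended block also contains the elements of the nonempty \<open>b\<close>, and no
  other block contains \<open>Suc m\<close>. This separates extensions from additions of a
  singleton.\<close>

lemma singleton_notin_extend:
  assumes "x \<in> pointed_partitions m"
  shows "{Suc m} \<notin> fst (extend_open m x)" "{Suc m} \<notin> fst (extend_closed m x)"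
proof -
  obtain P Q b where x: "x = ((P, Q), b)" by (metis prod.exhaust)
  have P: "partition_on {1..m} P" "b \<in> P"
    using assms by (auto simp: x pointed_partitions_def marked_partitions_def open_blocks_def)
  show "{Suc m} \<notin> fst (extend_open m x)" "{Suc m} \<notin> fst (extend_closed m x)"
    using singleton_not_in_partition[OF P(1)] partition_block_facts[OF P]
    by (auto simp: x extend_open_def extend_closed_def)
qed

text \<open>Separates the two kinds of extension: after \<open>extend_closed\<close> the open blocks
  are all old ones, hence subsets of \<open>{1..m}\<close>.\<close>

lemma max_in_open_extend:
  assumes "x \<in> pointed_partitions m"
  shows "Suc m \<in> \<Union>(snd (extend_open m x))" "Suc m \<notin> \<Union>(snd (extend_closed m x))"
proof -
  obtain P Q b where x: "x = ((P, Q), b)" by (metis prod.exhaust)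
  have P: "partition_on {1..m} P" "Q \<subseteq> P"
    using assms by (auto simp: x pointed_partitions_def marked_partitions_def)
  show "Suc m \<in> \<Union>(snd (extend_open m x))" "Suc m \<notin> \<Union>(snd (extend_closed m x))"
    using partition_block_facts(3)[OF P(1)] P(2) by (auto simp: x extend_open_def extend_closed_def)
qed

lemma inj_add:
  "inj_on (add_open m) (marked_partitions m)" "inj_on (add_closed m) (marked_partitions m)"
proof -
  have "{Suc m} \<notin> fst l \<and> {Suc m} \<notin> snd l" if "l \<in> marked_partitions m" for l
    using that singleton_not_in_partition by (auto simp: marked_partitions_def)
  thus "inj_on (add_open m) (marked_partitions m)" "inj_on (add_closed m) (marked_partitions m)"
    by (auto simp: inj_on_def add_open_def add_closed_def insert_ident prod_eq_iff)
qed

text \<open>The extended block is the only one containing \<open>Suc m\<close>, so it can be read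
  off from the result; deleting \<open>Suc m\<close> from it recovers \<open>b\<close>, and then the
  partition.\<close>

lemma extend_block_inj:
  assumes P: "partition_on {1..m} P" "b \<in> P" and R: "partition_on {1..m} R" "c \<in> R"
    and eq: "insert (insert (Suc m) b) (P - {b}) = insert (insert (Suc m) c) (R - {c})"
  shows "b = c" "P = R"
proof -
  have "insert (Suc m) b \<in> insert (insert (Suc m) c) (R - {c})" using eq by blast
  hence "insert (Suc m) b = insert (Suc m) c"
    using partition_block_facts(3)[OF R(1)] by blast
  thus bc: "b = c"
    using partition_block_facts(3)[OF P] partition_block_facts(3)[OF R] by (simp add: insert_ident)
  have "P - {b} = R - {c}"
    using eq partition_block_facts(5)[OF P] partition_block_facts(5)[OF R]
    by (simp add: bc insert_ident)
  thus "P = R" using bc P(2) R(2) by blast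
qed

lemma inj_extend:
  "inj_on (extend_open m) (pointed_partitions m)" "inj_on (extend_closed m) (pointed_partitions m)"
proof -
  \<comment> \<open>The disjunction in \<open>eq2\<close> covers both markings of the new block, so
    one argument serves both maps.\<close>
  have main: "((P, Q), b) = ((R, S), c)"
    if pt: "((P, Q), b) \<in> pointed_partitions m" "((R, S), c) \<in> pointed_partitions m"
      and eq: "insert (insert (Suc m) b) (P - {b}) = insert (insert (Suc m) c) (R - {c})"
      and eq2: "insert (insert (Suc m) b) (Q - {b}) = insert (insert (Suc m) c) (S - {c})
        \<or> Q - {b} = S - {c}" for P Q b R S c
  proof -
    have P: "partition_on {1..m} P" "b \<in> P" "b \<in> Q" "Q \<subseteq> P"
      and R: "partition_on {1..m} R" "c \<in> R" "c \<in> S" "S \<subseteq> R"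
      using pt by (auto simp: pointed_partitions_def marked_partitions_def open_blocks_def)
    note e = extend_block_inj[OF P(1,2) R(1,2) eq]
    have "insert (Suc m) b \<notin> Q" "insert (Suc m) b \<notin> S"
      using partition_block_facts(5)[OF P(1,2)] P(4) R(4) e by auto
    \<comment> \<open>The extended block is fresh, so it can be cancelled in the open case; putting
      \<open>b\<close> back then restores \<open>Q\<close> and \<open>S\<close>.\<close>
    hence "Q - {b} = S - {b}" using eq2 e by (auto simp: insert_ident)
    hence "Q = S" using P(3) R(3) e by blast
    thus ?thesis using e by simp
  qed
  show "inj_on (extend_open m) (pointed_partitions m)"
  proof (rule inj_onI)
    fix x y assume "x \<in> pointed_partitions m" "y \<in> pointed_partitions m"
      "extend_open m x = extend_open m y"
    thus "x = y" using main[of "fst (fst x)" "snd (fst x)" "snd x" "fst (fst y)" "snd (fst y)" "snd y"]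
      by (simp add: extend_open_def case_prod_beta)
  qed
  show "inj_on (extend_closed m) (pointed_partitions m)"
  proof (rule inj_onI)
    fix x y assume "x \<in> pointed_partitions m" "y \<in> pointed_partitions m"
      "extend_closed m x = extend_closed m y"
    thus "x = y" using main[of "fst (fst x)" "snd (fst x)" "snd x" "fst (fst y)" "snd (fst y)" "snd y"]
      by (simp add: extend_closed_def case_prod_beta)
  qed
qed

section \<open>Effect on the two statistics\<close>

lemmas statistic_defs = dtilde_def num_open_def num_blocks_def closed_blocks_def blocks_def
  open_blocks_def

text \<open>Write \<open>o\<close> for \<open>num_open l\<close>. The singleton changes minima and
  block count by \<open>- (m + 1) + 1 = - m\<close>. If it is open, the last term of
  \<open>dtilde\<close> grows from \<open>m * (o - 1)\<close> to \<open>(m + 1) * o\<close>, that is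
  by \<open>m + o\<close>. If it is closed, that term grows by \<open>o - 1\<close> and the maxima
  by \<open>m + 1\<close>. The total is \<open>o\<close> both times.\<close>

lemma statistics_add:
  assumes "l \<in> marked_partitions m"
  shows "num_open (add_open m l) = num_open l + 1"
    and "dtilde (Suc m) (add_open m l) = dtilde m l + num_open l"
    and "num_open (add_closed m l) = num_open l"
    and "dtilde (Suc m) (add_closed m l) = dtilde m l + num_open l"
proof -
  obtain P Q where l: "l = (P, Q)" and P: "partition_on {1..m} P" and Q: "Q \<subseteq> P"
    using assms by (auto simp: marked_partitions_def)
  have fin: "finite P" using P finite_elements by blast
  hence finQ: "finite Q" using Q finite_subset by blast
  have new: "{Suc m} \<notin> P" "{Suc m} \<notin> Q" using singleton_not_in_partition[OF P] Q by auto
  have *: "insert {Suc m} P - insert {Suc m} Q = P - Q"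
    "insert {Suc m} P - Q = insert {Suc m} (P - Q)" using new by auto
  show "num_open (add_open m l) = num_open l + 1"
    "dtilde (Suc m) (add_open m l) = dtilde m l + num_open l"
    "num_open (add_closed m l) = num_open l"
    "dtilde (Suc m) (add_closed m l) = dtilde m l + num_open l"
    using fin finQ new by (simp_all add: l add_open_def add_closed_def statistic_defs *
        algebra_simps)
qed

text \<open>Minima and block count do not change. With \<open>o = num_open l\<close>, keeping the
  block open raises only the last term of \<open>dtilde\<close>, by \<open>o - 1\<close>. Closing it
  adds the maximum \<open>m + 1\<close> and changes the last term by
  \<open>(m + 1) * (o - 2) - m * (o - 1) = o - m - 2\<close>, again \<open>o - 1\<close> in
  total.\<close>

lemma statistics_extend:
  assumes "(l, b) \<in> pointed_partitions m"
  shows "num_open (extend_open m (l, b)) = num_open l"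
    and "dtilde (Suc m) (extend_open m (l, b)) = dtilde m l + num_open l - 1"
    and "num_open (extend_closed m (l, b)) = num_open l - 1"
    and "dtilde (Suc m) (extend_closed m (l, b)) = dtilde m l + num_open l - 1"
proof -
  obtain P Q where l: "l = (P, Q)" and P: "partition_on {1..m} P" and Q: "Q \<subseteq> P" and bQ: "b \<in> Q"
    using assms by (auto simp: pointed_partitions_def marked_partitions_def open_blocks_def)
  have bP: "b \<in> P" using Q bQ by auto
  have fin: "finite P" using P finite_elements by blast
  hence finQ: "finite Q" using Q finite_subset by blast
  define c where "c = insert (Suc m) b"
  note b = partition_block_facts[OF P bP]
  have c: "c \<notin> P" "c \<notin> Q" using b(5) Q by (auto simp: c_def)
  have Maxc: "Max c = Suc m"
    unfolding c_def using b(1,4) by (intro Max_eqI) (auto simp: le_SucI)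
  have "Min b \<le> Suc m" using b(4)[OF Min_in[OF b(1,2)]] by simp
  hence Minc: "Min c = Min b" unfolding c_def using b(1,2) by simp
  \<comment> \<open>Positivity makes removing \<open>b\<close> and inserting \<open>c\<close> cancel
    despite truncated subtraction.\<close>
  have "card P > 0" "card Q > 0" using fin finQ bP bQ by (auto simp: card_gt_0_iff)
  hence cards: "card (insert c (P - {b})) = card P" "card (insert c (Q - {b})) = card Q"
    "int (card (Q - {b})) = int (card Q) - 1"
    using fin finQ bP bQ c by (simp_all add: card_insert_if)
  have mins: "(\<Sum>d\<in>insert c (P - {b}). int (Min d)) = (\<Sum>d\<in>P. int (Min d))"
    using fin c bP Minc by (simp add: sum.remove[OF fin bP])
  \<comment> \<open>As \<open>b\<close> is open, its removal takes nothing away from the closed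
    blocks.\<close>
  have closed: "insert c (P - {b}) - insert c (Q - {b}) = P - Q"
    "insert c (P - {b}) - (Q - {b}) = insert c (P - Q)" using c bQ bP by auto
  have maxs: "(\<Sum>d\<in>insert c (P - Q). int (Max d)) = int (Suc m) + (\<Sum>d\<in>P - Q. int (Max d))"
    using fin c Maxc by simp
  show "num_open (extend_open m (l, b)) = num_open l"
    "dtilde (Suc m) (extend_open m (l, b)) = dtilde m l + num_open l - 1"
    "num_open (extend_closed m (l, b)) = num_open l - 1"
    "dtilde (Suc m) (extend_closed m (l, b)) = dtilde m l + num_open l - 1"
    by (simp_all add: l extend_open_def extend_closed_def statistic_defs c_def[symmetric]
        cards mins closed maxs del: sum.insert card_insert_disjoint)
       (simp_all add: algebra_simps)
qed

section \<open>Counting\<close>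

text \<open>Each marked partition counted by \<open>f m A B\<close> has exactly \<open>A\<close>
  open blocks to choose from. For negative \<open>A\<close> both sides vanish.\<close>

lemma card_pointed_level:
  "int (card {x \<in> pointed_partitions m. num_open (fst x) = A \<and> dtilde m (fst x) = B})
    = A * int (f m A B)"
proof -
  let ?S = "{l \<in> marked_partitions m. num_open l = A \<and> dtilde m l = B}"
  have fin: "finite ?S" using finite_marked_partitions by simp
  have fin_open: "finite (open_blocks l)" if "l \<in> ?S" for l
  proof -
    have "partition_on {1..m} (fst l)" "open_blocks l \<subseteq> fst l"
      using that by (auto simp: marked_partitions_def open_blocks_def)
    thus ?thesis using finite_elements[of "{1..m}"] finite_subset by blast
  qed
  have "{x \<in> pointed_partitions m. num_open (fst x) = A \<and> dtilde m (fst x) = B}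
    = Sigma ?S open_blocks"
    by (auto simp: pointed_partitions_def)
  moreover have "card (Sigma ?S open_blocks) = (\<Sum>l\<in>?S. card (open_blocks l))"
    using fin fin_open by (intro card_SigmaI) auto
  moreover have "int (\<Sum>l\<in>?S. card (open_blocks l)) = (\<Sum>l\<in>?S. A)"
    unfolding of_nat_sum by (intro sum.cong) (auto simp: num_open_def)
  ultimately show ?thesis by (simp add: f_def)
qed

lemma card_filter_image:
  assumes "inj_on g D"
  shows "card {y \<in> g ` D. R y} = card {x \<in> D. R (g x)}"
proof -
  have "{y \<in> g ` D. R y} = g ` {x \<in> D. R (g x)}" by auto
  moreover have "inj_on g {x \<in> D. R (g x)}" using assms by (rule inj_on_subset) auto
  ultimately show ?thesis by (simp add: card_image)
qed

text \<open>One summand per image. Its arguments solve the shift equations: \<open>add_open\<close>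
  starts from \<open>A - 1\<close> open blocks and raises \<open>dtilde\<close> by
  \<open>A - 1\<close>; \<open>add_closed\<close> starts from \<open>A\<close> and raises it by
  \<open>A\<close>; \<open>extend_open\<close> starts from \<open>A\<close> and raises it by
  \<open>A - 1\<close>; \<open>extend_closed\<close> starts from \<open>A + 1\<close> and raises it
  by \<open>A\<close>.\<close>

lemma f_Suc:
  "int (f (Suc m) A B) =
     int (f m (A - 1) (B - A + 1)) + int (f m A (B - A))
     + A * int (f m A (B - A + 1)) + (A + 1) * int (f m (A + 1) (B - A))"
proof -
  let ?R = "\<lambda>l. num_open l = A \<and> dtilde (Suc m) l = B"
  let ?M = "marked_partitions m" and ?N = "pointed_partitions m"
  let ?T1 = "{l \<in> add_open m ` ?M. ?R l}" and ?T2 = "{l \<in> add_closed m ` ?M. ?R l}"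
  let ?T3 = "{l \<in> extend_open m ` ?N. ?R l}" and ?T4 = "{l \<in> extend_closed m ` ?N. ?R l}"
  have split: "{l \<in> marked_partitions (Suc m). ?R l} = ?T1 \<union> ?T2 \<union> ?T3 \<union> ?T4"
    by (auto simp: marked_partitions_Suc)
  have "finite {l \<in> marked_partitions (Suc m). ?R l}" using finite_marked_partitions by simp
  hence fin: "finite ?T1" "finite ?T2" "finite ?T3" "finite ?T4" unfolding split by auto
  have "?T1 \<inter> ?T2 = {}"
  proof -
    have "add_open m x \<noteq> add_closed m y" if "y \<in> ?M" for x y
      using singleton_in_add(1) singleton_notin_add_closed that by metis
    thus ?thesis by blast
  qed
  moreover have "(?T1 \<union> ?T2) \<inter> ?T3 = {}"
  proof -
    have "add_open m x \<noteq> extend_open m y" "add_closed m x \<noteq> extend_open m y" if "y \<in> ?N" for x y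
      using singleton_in_add(2,3) singleton_notin_extend(1) that by metis+
    thus ?thesis by blast
  qed
  moreover have "(?T1 \<union> ?T2) \<inter> ?T4 = {}"
  proof -
    have "add_open m x \<noteq> extend_closed m y" "add_closed m x \<noteq> extend_closed m y" if "y \<in> ?N" for x y
      using singleton_in_add(2,3) singleton_notin_extend(2) that by metis+
    thus ?thesis by blast
  qed
  moreover have "?T3 \<inter> ?T4 = {}"
  proof -
    have "extend_open m x \<noteq> extend_closed m y" if "x \<in> ?N" "y \<in> ?N" for x y
      using max_in_open_extend that by metis
    thus ?thesis by blast
  qed
  ultimately have "f (Suc m) A B = card ?T1 + card ?T2 + card ?T3 + card ?T4"
    unfolding f_def split using fin by (simp add: card_Un_disjoint Int_Un_distrib2)
  moreover have "card ?T1 = f m (A - 1) (B - A + 1)"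
    unfolding card_filter_image[OF inj_add(1)] f_def
    by (intro arg_cong[where f = card]) (auto simp: statistics_add)
  moreover have "card ?T2 = f m A (B - A)"
    unfolding card_filter_image[OF inj_add(2)] f_def
    by (intro arg_cong[where f = card]) (auto simp: statistics_add)
  moreover have "int (card ?T3) = A * int (f m A (B - A + 1))"
    unfolding card_filter_image[OF inj_extend(1)] card_pointed_level[symmetric]
    by (intro arg_cong[where f = "\<lambda>S. int (card S)"]) (auto simp: statistics_extend)
  moreover have "int (card ?T4) = (A + 1) * int (f m (A + 1) (B - A))"
    unfolding card_filter_image[OF inj_extend(2)] card_pointed_level[symmetric]
    by (intro arg_cong[where f = "\<lambda>S. int (card S)"]) (auto simp: statistics_extend)
  ultimately show ?thesis by simp
qed

lemma f_0: "f 0 A B = (if (A, B) = (0, 0) then 1 else 0)"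
proof -
  have "marked_partitions 0 = {({}, {})}"
    by (auto simp: marked_partitions_def partition_on_empty)
  \<comment> \<open>The term \<open>n * (num_open l - 1)\<close> is \<open>0 * (- 1)\<close>, so it
    contributes nothing.\<close>
  moreover have "num_open ({}, {}) = 0" "dtilde 0 ({}, {}) = 0"
    by (simp_all add: statistic_defs)
  ultimately have "{l \<in> marked_partitions 0. num_open l = A \<and> dtilde 0 l = B} =
    (if (A, B) = (0, 0) then {({}, {})} else {})"
    by auto
  thus ?thesis by (simp add: f_def)
qed

theorem theorem4p1:
  "(\<forall>n::nat. \<forall>A B::int. n > 0 \<longrightarrow>
      int (f n A B) =
        int (f (n - 1) (A - 1) (B - A + 1))
        + int (f (n - 1) A (B - A))
        + A * int (f (n - 1) A (B - A + 1))
        + (A + 1) * int (f (n - 1) (A + 1) (B - A)))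
   \<and> f 0 0 0 = 1
   \<and> (\<forall>A B::int. (A, B) \<noteq> (0, 0) \<longrightarrow> f 0 A B = 0)"
proof (intro conjI allI impI)
  fix n :: nat and A B :: int
  assume "n > 0"
  then obtain m where "n = Suc m" using gr0_implies_Suc by blast
  thus "int (f n A B) = int (f (n - 1) (A - 1) (B - A + 1)) + int (f (n - 1) A (B - A))
      + A * int (f (n - 1) A (B - A + 1)) + (A + 1) * int (f (n - 1) (A + 1) (B - A))"
    using f_Suc by simp
qed (simp_all add: f_0)

end
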